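(* Let $(N_m)_{m\ge0}$ be positive integers with $N_0=N$, and for each $m\ge1$ let $W_m:\mathbb{R}^{N_{m-1}}\to\mathbb{C}^{N_m}$ be linear with $W_m^*W_m=\mathrm{Id}$. Let $X$ be a random vector in $\mathbb{R}^N$ with $E(\|X\|^2)<\infty$, with expected scattering layers $(X_m)_{m\ge0}$. Let $X_1',\dots,X_P'$ be independent random vectors each having the same distribution as $X$. Define $\overline X_{i,0}=X_i'$ and, for $m\ge0$, $$\overline\mu_m=\frac1P\sum_{i=1}^P\overline X_{i,m},\qquad \overline X_{i,m+1}=|W_{m+1}(\overline X_{i,m}-\overline\mu_m)|.$$ Then for every $m\ge0$, $$E\big(\|\overline\mu_m-E(X_m)\|^2\big)\le \frac1P\Big(\sum_{n=0}^m\Big(\sum_{k=n+1}^\infty\|E(X_k)\|^2\Big)^{1/2}\Big)^2\le \frac{(m+1)^2}{P}\,E(\|X\|^2).$$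
   Context: For $z\in\mathbb{C}^n$, $|z|$ denotes the vector of coordinatewise complex moduli; $\|\cdot\|$ is the Euclidean norm. Expected scattering layers: $X_0=X$ and $X_{m+1}=|W_{m+1}(X_m-E(X_m))|\in\mathbb{R}^{N_{m+1}}$ for $m\ge0$. *)

theory Defs
  imports "HOL-Probability.Probability"
begin

text \<open>Vectors of R^n / C^n are represented as functions on nat; only indices < n matter.
  A real-linear map W : R^n \<rightarrow> C^n' is given by its complex matrix w (w j k, j < n', k < n).\<close>

definition applyW :: "(nat \<Rightarrow> nat \<Rightarrow> complex) \<Rightarrow> nat \<Rightarrow> nat \<Rightarrow> (nat \<Rightarrow> real) \<Rightarrow> nat \<Rightarrow> complex" where
  "applyW w n n' x j = (if j < n' then (\<Sum>k<n. w j k * complex_of_real (x k)) else 0)"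

text \<open>Adjoint W* : C^n' \<rightarrow> R^n for the real inner products
  <x,y> = sum x_k y_k on R^n and <u,z> = Re (sum cnj u_j * z_j) on C^n'.\<close>
definition adjW :: "(nat \<Rightarrow> nat \<Rightarrow> complex) \<Rightarrow> nat \<Rightarrow> nat \<Rightarrow> (nat \<Rightarrow> complex) \<Rightarrow> nat \<Rightarrow> real" where
  "adjW w n n' z k = (if k < n then Re (\<Sum>j<n'. cnj (w j k) * z j) else 0)"

definition adj_isometry :: "(nat \<Rightarrow> nat \<Rightarrow> complex) \<Rightarrow> nat \<Rightarrow> nat \<Rightarrow> bool" where
  "adj_isometry w n n' \<longleftrightarrow>
     (\<forall>x. (\<forall>k. n \<le> k \<longrightarrow> x k = 0) \<longrightarrow> adjW w n n' (applyW w n n' x) = x)"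

definition sqnorm :: "nat \<Rightarrow> (nat \<Rightarrow> real) \<Rightarrow> real" where
  "sqnorm n v = (\<Sum>k<n. (v k)\<^sup>2)"

fun layer :: "'a measure \<Rightarrow> (nat \<Rightarrow> nat) \<Rightarrow> (nat \<Rightarrow> nat \<Rightarrow> nat \<Rightarrow> complex)
    \<Rightarrow> ('a \<Rightarrow> nat \<Rightarrow> real) \<Rightarrow> nat \<Rightarrow> 'a \<Rightarrow> nat \<Rightarrow> real" where
  "layer M Ns W X 0 = X"
| "layer M Ns W X (Suc m) = (\<lambda>\<omega> j. cmod (applyW (W (Suc m)) (Ns m) (Ns (Suc m))
      (\<lambda>k. layer M Ns W X m \<omega> k - (\<integral>\<omega>'. layer M Ns W X m \<omega>' k \<partial>M)) j))"

fun emp_layer :: "(nat \<Rightarrow> nat) \<Rightarrow> (nat \<Rightarrow> nat \<Rightarrow> nat \<Rightarrow> complex) \<Rightarrow> nat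
    \<Rightarrow> (nat \<Rightarrow> 'a \<Rightarrow> nat \<Rightarrow> real) \<Rightarrow> nat \<Rightarrow> nat \<Rightarrow> 'a \<Rightarrow> nat \<Rightarrow> real" where
  "emp_layer Ns W P Xp 0 = Xp"
| "emp_layer Ns W P Xp (Suc m) = (\<lambda>i \<omega> j. cmod (applyW (W (Suc m)) (Ns m) (Ns (Suc m))
      (\<lambda>k. emp_layer Ns W P Xp m i \<omega> k
           - (1 / real P) * (\<Sum>i'=1..P. emp_layer Ns W P Xp m i' \<omega> k)) j))"

definition emp_mean :: "(nat \<Rightarrow> nat) \<Rightarrow> (nat \<Rightarrow> nat \<Rightarrow> nat \<Rightarrow> complex) \<Rightarrow> nat
    \<Rightarrow> (nat \<Rightarrow> 'a \<Rightarrow> nat \<Rightarrow> real) \<Rightarrow> nat \<Rightarrow> 'a \<Rightarrow> nat \<Rightarrow> real" where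
  "emp_mean Ns W P Xp m \<omega> k = (1 / real P) * (\<Sum>i=1..P. emp_layer Ns W P Xp m i \<omega> k)"

end

theory Submission
  imports Defs
begin

text \<open>Each layer map is nonexpansive in mean square, and centring splits the energy of layer \<open>m\<close> into its
  variance \<open>v\<^sub>m\<close> and \<open>\<parallel>E X\<^sub>m\<parallel>\<^sup>2\<close>; since layer \<open>m + 1\<close> has energy \<open>v\<^sub>m\<close>, telescoping gives
  \<open>v\<^sub>n = (\<Sum>k>n. \<parallel>E X\<^sub>k\<parallel>\<^sup>2)\<close> once \<open>v\<^sub>m \<longlonglongrightarrow> 0\<close> is known. The latter is elementary for finitely valued \<open>X\<close>
  and passes to the general case by approximation, because the layers are nonexpansive.

  For the estimation error, let \<open>D\<^sub>m\<close> be the mean squared distance between the empirical layers and the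
  same samples propagated with the true means. The variance of an average of \<open>P\<close> independent samples
  gives \<open>D\<^sub>m\<^sub>+\<^sub>1 \<le> D\<^sub>m + v\<^sub>m / P\<close>, and Minkowski's inequality bounds the root mean squared error of the
  empirical mean by \<open>sqrt D\<^sub>m + sqrt (v\<^sub>m / P)\<close>.\<close>

section \<open>Square-integrable random vectors\<close>

text \<open>Measurability is a separate clause because integrability of the square leaves the sign
  of \<open>f\<close> uncontrolled.\<close>

definition square_integrable :: "'a measure \<Rightarrow> ('a \<Rightarrow> real) \<Rightarrow> bool" where
  "square_integrable M f \<longleftrightarrow> f \<in> borel_measurable M \<and> integrable M (\<lambda>\<omega>. (f \<omega>)\<^sup>2)"

definition vec_square_integrable :: "'a measure \<Rightarrow> nat \<Rightarrow> ('a \<Rightarrow> nat \<Rightarrow> real) \<Rightarrow> bool" where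
  "vec_square_integrable M n Y \<longleftrightarrow> (\<forall>k<n. square_integrable M (\<lambda>\<omega>. Y \<omega> k))"

lemma square_integrable_measurable:
  "square_integrable M f \<Longrightarrow> f \<in> borel_measurable M"
  by (simp add: square_integrable_def)

lemma square_integrable_power2:
  "square_integrable M f \<Longrightarrow> integrable M (\<lambda>\<omega>. (f \<omega>)\<^sup>2)"
  by (simp add: square_integrable_def)

lemma square_integrable_bound:
  assumes "f \<in> borel_measurable M" "integrable M g" "\<And>\<omega>. (f \<omega>)\<^sup>2 \<le> g \<omega>"
  shows "square_integrable M f"
  unfolding square_integrable_def
proof
  show "integrable M (\<lambda>\<omega>. (f \<omega>)\<^sup>2)"
    by (rule Bochner_Integration.integrable_bound[OF assms(2)])
      (use assms in \<open>auto intro!: AE_I2 order_trans[OF _ abs_ge_self]\<close>)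
qed (fact assms)

lemma square_integrable_cmult:
  "square_integrable M f \<Longrightarrow> square_integrable M (\<lambda>\<omega>. c * f \<omega>)"
  unfolding square_integrable_def by (auto simp: power_mult_distrib)

lemma square_integrable_add:
  assumes "square_integrable M f" "square_integrable M g"
  shows "square_integrable M (\<lambda>\<omega>. f \<omega> + g \<omega>)"
proof (rule square_integrable_bound)
  show "integrable M (\<lambda>\<omega>. 2 * (f \<omega>)\<^sup>2 + 2 * (g \<omega>)\<^sup>2)"
    using assms by (simp add: square_integrable_def)
  show "(f \<omega> + g \<omega>)\<^sup>2 \<le> 2 * (f \<omega>)\<^sup>2 + 2 * (g \<omega>)\<^sup>2" for \<omega>
    using zero_le_power2[of "f \<omega> - g \<omega>"] by (simp add: power2_sum power2_diff)
qed (use assms in \<open>auto simp: square_integrable_def\<close>)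

lemma square_integrable_diff:
  assumes "square_integrable M f" "square_integrable M g"
  shows "square_integrable M (\<lambda>\<omega>. f \<omega> - g \<omega>)"
  using square_integrable_add[OF assms(1) square_integrable_cmult[OF assms(2), of "-1"]] by simp

lemma square_integrable_sum:
  assumes "\<And>i. i \<in> I \<Longrightarrow> square_integrable M (f i)"
  shows "square_integrable M (\<lambda>\<omega>. \<Sum>i\<in>I. f i \<omega>)"
  using assms
proof (induction I rule: infinite_finite_induct)
  case (insert i I)
  then show ?case by (simp add: square_integrable_add)
qed (auto simp: square_integrable_def)

lemma square_integrable_mult:
  assumes "square_integrable M f" "square_integrable M g"
  shows "integrable M (\<lambda>\<omega>. f \<omega> * g \<omega>)"
proof (rule Bochner_Integration.integrable_bound)
  show "integrable M (\<lambda>\<omega>. (f \<omega>)\<^sup>2 + (g \<omega>)\<^sup>2)"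
    using assms by (simp add: square_integrable_def)
  have "\<bar>a * b\<bar> \<le> a\<^sup>2 + b\<^sup>2" for a b :: real
    using sum_squares_bound[of "\<bar>a\<bar>" "\<bar>b\<bar>"] mult_nonneg_nonneg[of "\<bar>a\<bar>" "\<bar>b\<bar>"]
    unfolding power2_abs abs_mult by linarith
  then show "AE \<omega> in M. norm (f \<omega> * g \<omega>) \<le> norm ((f \<omega>)\<^sup>2 + (g \<omega>)\<^sup>2)"
    by simp
qed (use assms in \<open>auto simp: square_integrable_def\<close>)

lemma (in prob_space) square_integrable_const: "square_integrable M (\<lambda>\<omega>. c)"
  by (simp add: square_integrable_def)

lemma (in prob_space) square_integrable_integrable:
  "square_integrable M f \<Longrightarrow> integrable M f"
  by (auto simp: square_integrable_def intro: square_integrable_imp_integrable)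

lemma vec_square_integrable_diff:
  "vec_square_integrable M n Y \<Longrightarrow> vec_square_integrable M n Z \<Longrightarrow>
    vec_square_integrable M n (\<lambda>\<omega> k. Y \<omega> k - Z \<omega> k)"
  by (simp add: vec_square_integrable_def square_integrable_diff)

lemma (in prob_space) vec_square_integrable_const: "vec_square_integrable M n (\<lambda>\<omega>. c)"
  by (simp add: vec_square_integrable_def square_integrable_const)

lemma integrable_sqnorm:
  "vec_square_integrable M n Y \<Longrightarrow> integrable M (\<lambda>\<omega>. sqnorm n (Y \<omega>))"
  unfolding sqnorm_def vec_square_integrable_def
  by (intro Bochner_Integration.integrable_sum) (auto simp: square_integrable_def)

lemma integral_sqnorm:
  "vec_square_integrable M n Y \<Longrightarrow>
    (\<integral>\<omega>. sqnorm n (Y \<omega>) \<partial>M) = (\<Sum>k<n. \<integral>\<omega>. (Y \<omega> k)\<^sup>2 \<partial>M)"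
  unfolding sqnorm_def vec_square_integrable_def
  by (intro Bochner_Integration.integral_sum) (auto simp: square_integrable_def)

lemma sqnorm_nonneg: "0 \<le> sqnorm n x"
  by (simp add: sqnorm_def sum_nonneg)

lemma sqnorm_diff_le: "sqnorm n (\<lambda>k. x k - y k) \<le> 2 * sqnorm n x + 2 * sqnorm n y"
  unfolding sqnorm_def sum_distrib_left sum.distrib[symmetric]
proof (rule sum_mono)
  show "(x k - y k)\<^sup>2 \<le> 2 * (x k)\<^sup>2 + 2 * (y k)\<^sup>2" for k
    using zero_le_power2[of "x k + y k"] by (simp add: power2_sum power2_diff)
qed

lemma power2_component_le_sqnorm: "j < n \<Longrightarrow> (x j)\<^sup>2 \<le> sqnorm n x"
  unfolding sqnorm_def by (rule member_le_sum) auto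

text \<open>The scalar identity "second moment = variance + squared mean", summed over the
  coordinates.\<close>

lemma (in prob_space) integral_sqnorm_mean:
  assumes "vec_square_integrable M n Y"
  shows "(\<integral>\<omega>. sqnorm n (Y \<omega>) \<partial>M) =
    (\<integral>\<omega>. sqnorm n (\<lambda>k. Y \<omega> k - (\<integral>\<omega>'. Y \<omega>' k \<partial>M)) \<partial>M) + sqnorm n (\<lambda>k. \<integral>\<omega>. Y \<omega> k \<partial>M)"
proof -
  have "(\<Sum>k<n. \<integral>\<omega>. (Y \<omega> k)\<^sup>2 \<partial>M) = (\<Sum>k<n. \<integral>\<omega>. (Y \<omega> k - (\<integral>\<omega>'. Y \<omega>' k \<partial>M))\<^sup>2 \<partial>M) +
      (\<Sum>k<n. (\<integral>\<omega>. Y \<omega> k \<partial>M)\<^sup>2)"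
    unfolding sum.distrib[symmetric]
  proof (rule sum.cong[OF refl])
    fix k assume "k \<in> {..<n}"
    then have k: "square_integrable M (\<lambda>\<omega>. Y \<omega> k)"
      using assms by (simp add: vec_square_integrable_def)
    show "(\<integral>\<omega>. (Y \<omega> k)\<^sup>2 \<partial>M) = (\<integral>\<omega>. (Y \<omega> k - (\<integral>\<omega>'. Y \<omega>' k \<partial>M))\<^sup>2 \<partial>M) + (\<integral>\<omega>. Y \<omega> k \<partial>M)\<^sup>2"
      using variance_eq[OF square_integrable_integrable[OF k] square_integrable_power2[OF k]]
      by simp
  qed
  moreover have "vec_square_integrable M n (\<lambda>\<omega> k. Y \<omega> k - (\<integral>\<omega>'. Y \<omega>' k \<partial>M))"
    by (intro vec_square_integrable_diff assms vec_square_integrable_const)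
  ultimately show ?thesis
    by (simp add: integral_sqnorm assms) (simp add: sqnorm_def)
qed

text \<open>Splitting \<open>Y - c\<close> around its own mean leaves the centred \<open>Y\<close>
  and the squared norm of that mean, which is dropped.\<close>

lemma (in prob_space) integral_sqnorm_centre_le:
  assumes "vec_square_integrable M n Y"
  shows "(\<integral>\<omega>. sqnorm n (\<lambda>k. Y \<omega> k - (\<integral>\<omega>'. Y \<omega>' k \<partial>M)) \<partial>M) \<le>
    (\<integral>\<omega>. sqnorm n (\<lambda>k. Y \<omega> k - c k) \<partial>M)"
proof -
  have eq: "(\<integral>\<omega>. Y \<omega> k - c k \<partial>M) = (\<integral>\<omega>. Y \<omega> k \<partial>M) - c k" if "k < n" for k
    using assms that by (simp add: vec_square_integrable_def square_integrable_integrable prob_space)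
  have "(\<integral>\<omega>. sqnorm n (\<lambda>k. (Y \<omega> k - c k) - (\<integral>\<omega>'. Y \<omega>' k - c k \<partial>M)) \<partial>M) \<le>
      (\<integral>\<omega>. sqnorm n (\<lambda>k. Y \<omega> k - c k) \<partial>M)"
    by (subst (2) integral_sqnorm_mean)
      (auto intro!: vec_square_integrable_diff assms vec_square_integrable_const simp: sqnorm_nonneg)
  moreover have "sqnorm n (\<lambda>k. (Y \<omega> k - c k) - (\<integral>\<omega>'. Y \<omega>' k - c k \<partial>M)) =
      sqnorm n (\<lambda>k. Y \<omega> k - (\<integral>\<omega>'. Y \<omega>' k \<partial>M))" for \<omega>
    unfolding sqnorm_def by (intro sum.cong refl) (simp add: eq)
  ultimately show ?thesis by simp
qed

section \<open>The modulus of an isometric linear map\<close>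

text \<open>Pairing \<open>W*W x = x\<close> with \<open>x\<close> gives <x, x> = <x, W*W x> = <W x,
  W x> for the real inner products.\<close>

lemma sqnorm_cmod_applyW:
  assumes "adj_isometry w n n'"
  shows "sqnorm n' (\<lambda>j. cmod (applyW w n n' x j)) = sqnorm n x"
proof -
  \<comment> \<open>\<open>adj_isometry\<close> speaks only of vectors vanishing from
    \<open>n\<close> on, whereas \<open>x\<close> is arbitrary there; \<open>applyW\<close> does not
    see the difference.\<close>
  define y where "y k = (if k < n then x k else 0)" for k
  have y: "applyW w n n' y = applyW w n n' x"
    by (auto simp: applyW_def y_def fun_eq_iff)
  have "adjW w n n' (applyW w n n' y) = y"
    using assms by (simp add: adj_isometry_def y_def)
  then have ad: "Re (\<Sum>j<n'. cnj (w j k) * applyW w n n' x j) = x k" if "k < n" for k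
    using that y by (auto simp: adjW_def y_def dest!: fun_cong[of _ _ k])
  have "sqnorm n x = (\<Sum>k<n. x k * Re (\<Sum>j<n'. cnj (w j k) * applyW w n n' x j))"
    unfolding sqnorm_def by (intro sum.cong refl) (simp add: ad power2_eq_square del: Re_sum)
  also have "\<dots> = (\<Sum>k<n. \<Sum>j<n'. Re (of_real (x k) * cnj (w j k) * applyW w n n' x j))"
    by (simp add: sum_distrib_left algebra_simps)
  also have "\<dots> = (\<Sum>j<n'. Re (\<Sum>k<n. of_real (x k) * cnj (w j k) * applyW w n n' x j))"
    unfolding Re_sum by (rule sum.swap)
  also have "\<dots> = (\<Sum>j<n'. Re (cnj (applyW w n n' x j) * applyW w n n' x j))"
    unfolding sum_distrib_right[symmetric]
    by (intro sum.cong refl arg_cong[where f = Re]) (simp add: applyW_def mult.commute)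
  also have "\<dots> = sqnorm n' (\<lambda>j. cmod (applyW w n n' x j))"
    unfolding sqnorm_def by (intro sum.cong refl) (simp add: cmod_power2, simp add: power2_eq_square)
  finally show ?thesis by simp
qed

text \<open>The reverse triangle inequality in each coordinate reduces the claim to the isometry
  applied to \<open>x - y\<close>.\<close>

lemma sqnorm_cmod_applyW_diff_le:
  assumes "adj_isometry w n n'"
  shows "sqnorm n' (\<lambda>j. cmod (applyW w n n' x j) - cmod (applyW w n n' y j)) \<le> sqnorm n (\<lambda>k. x k - y k)"
proof -
  have lin: "applyW w n n' (\<lambda>k. x k - y k) j = applyW w n n' x j - applyW w n n' y j" for j
    by (simp add: applyW_def algebra_simps sum_subtractf)
  have "sqnorm n' (\<lambda>j. cmod (applyW w n n' x j) - cmod (applyW w n n' y j)) \<le>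
      sqnorm n' (\<lambda>j. cmod (applyW w n n' (\<lambda>k. x k - y k) j))"
    unfolding sqnorm_def lin
    by (intro sum_mono) (simp add: norm_triangle_ineq3 flip: abs_le_square_iff)
  then show ?thesis by (simp add: sqnorm_cmod_applyW[OF assms])
qed

lemma measurable_cmod_applyW:
  assumes "\<And>k. k < n \<Longrightarrow> (\<lambda>\<omega>. x \<omega> k) \<in> borel_measurable M"
  shows "(\<lambda>\<omega>. cmod (applyW w n n' (x \<omega>) j)) \<in> borel_measurable M"
  unfolding applyW_def using assms
  by (cases "j < n'") (auto intro!: borel_measurable_norm borel_measurable_sum borel_measurable_times
    borel_measurable_of_real simp del: norm_of_real)

lemma vec_square_integrable_cmod_applyW:
  assumes "adj_isometry w n n'" "vec_square_integrable M n Y"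
  shows "vec_square_integrable M n' (\<lambda>\<omega> j. cmod (applyW w n n' (Y \<omega>) j))"
  unfolding vec_square_integrable_def
proof (intro allI impI)
  fix j assume "j < n'"
  show "square_integrable M (\<lambda>\<omega>. cmod (applyW w n n' (Y \<omega>) j))"
  proof (rule square_integrable_bound[OF measurable_cmod_applyW integrable_sqnorm[OF assms(2)]])
    show "(\<lambda>\<omega>. Y \<omega> k) \<in> borel_measurable M" if "k < n" for k
      using assms(2) that by (simp add: vec_square_integrable_def square_integrable_def)
    show "(cmod (applyW w n n' (Y \<omega>) j))\<^sup>2 \<le> sqnorm n (Y \<omega>)" for \<omega>
      using power2_component_le_sqnorm[OF \<open>j < n'\<close>, of "\<lambda>j. cmod (applyW w n n' (Y \<omega>) j)"]
      by (simp add: sqnorm_cmod_applyW[OF assms(1)])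
  qed
qed

section \<open>Mean-square approximation by finitely valued random vectors\<close>

text \<open>Finiteness of the range concerns the whole vector, so the coordinates are adjoined one
  at a time and the tail is fixed at 0.\<close>

lemma simple_function_vec:
  fixes s :: "nat \<Rightarrow> 'a \<Rightarrow> 'b::zero"
  assumes "\<And>k. k < n \<Longrightarrow> simple_function M (s k)"
  shows "simple_function M (\<lambda>\<omega> k. if k < n then s k \<omega> else 0)"
  using assms
proof (induction n)
  case (Suc n)
  have "simple_function M (\<lambda>\<omega>. (\<lambda>k. if k < n then s k \<omega> else 0)(n := s n \<omega>))"
    by (rule simple_function_compose2[where h = "\<lambda>f v. f(n := v)"]) (use Suc in auto)
  moreover have "(\<lambda>\<omega>. (\<lambda>k. if k < n then s k \<omega> else 0)(n := s n \<omega>)) =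
      (\<lambda>\<omega> k. if k < Suc n then s k \<omega> else 0)"
    by (auto simp: fun_eq_iff)
  ultimately show ?case by simp
qed simp

text \<open>Each coordinate has simple approximations bounded by twice its modulus, and dominated
  convergence sends the mean squared errors to zero.\<close>

lemma vec_square_integrable_simple_approx:
  assumes X: "vec_square_integrable M n X" and "e > 0"
  obtains Y where "simple_function M Y" "vec_square_integrable M n Y"
    "(\<integral>\<omega>. sqnorm n (\<lambda>k. X \<omega> k - Y \<omega> k) \<partial>M) < e"
proof -
  have "\<forall>k. \<exists>F. k < n \<longrightarrow> (\<forall>i. simple_function M (F i)) \<and>
      (\<forall>\<omega>\<in>space M. (\<lambda>i. F i \<omega>) \<longlonglongrightarrow> X \<omega> k) \<and> (\<forall>i. \<forall>\<omega>\<in>space M. dist (F i \<omega>) 0 \<le> 2 * dist (X \<omega> k) 0)"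
    using borel_measurable_implies_sequence_metric[of "\<lambda>\<omega>. X \<omega> _" M 0] X
    by (auto simp: vec_square_integrable_def square_integrable_def)
  from choice[OF this] obtain s where s0: "\<forall>k<n. (\<forall>i. simple_function M (s k i)) \<and>
      (\<forall>\<omega>\<in>space M. (\<lambda>i. s k i \<omega>) \<longlonglongrightarrow> X \<omega> k) \<and>
      (\<forall>i. \<forall>\<omega>\<in>space M. dist (s k i \<omega>) 0 \<le> 2 * dist (X \<omega> k) 0)"
    by blast
  have s: "\<And>k i. k < n \<Longrightarrow> simple_function M (s k i)"
      "\<And>k \<omega>. k < n \<Longrightarrow> \<omega> \<in> space M \<Longrightarrow> (\<lambda>i. s k i \<omega>) \<longlonglongrightarrow> X \<omega> k"
      "\<And>k i \<omega>. k < n \<Longrightarrow> \<omega> \<in> space M \<Longrightarrow> \<bar>s k i \<omega>\<bar> \<le> 2 * \<bar>X \<omega> k\<bar>"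
    using s0 by (simp_all add: dist_real_def)
  define Y where "Y i \<omega> k = (if k < n then s k i \<omega> else 0)" for i \<omega> k
  have meas: "s k i \<in> borel_measurable M" if "k < n" for k i
    using s(1)[OF that] by (rule borel_measurable_simple_function)
  have Xk: "square_integrable M (\<lambda>\<omega>. X \<omega> k)" if "k < n" for k
    using X that by (simp add: vec_square_integrable_def)
  have Y: "vec_square_integrable M n (Y i)" for i
    unfolding vec_square_integrable_def square_integrable_def
  proof (intro allI impI conjI)
    fix k assume k: "k < n"
    show "(\<lambda>\<omega>. Y i \<omega> k) \<in> borel_measurable M" using meas[OF k] k by (simp add: Y_def)
    have "(s k i \<omega>)\<^sup>2 \<le> 4 * (X \<omega> k)\<^sup>2" if "\<omega> \<in> space M" for \<omega>
      using power_mono[OF s(3)[OF k that, of i], of 2] by (simp add: power_mult_distrib)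
    then show "integrable M (\<lambda>\<omega>. (Y i \<omega> k)\<^sup>2)"
      by (intro Bochner_Integration.integrable_bound[OF integrable_mult_right[OF
        square_integrable_power2[OF Xk[OF k]], of 4]] borel_measurable_power)
        (use meas[OF k] k in \<open>auto simp: Y_def\<close>)
  qed
  \<comment> \<open>The factor 2 in the bound on the approximations makes the error at most three
    times the modulus, whence the 9 in the dominating function.\<close>
  have lim: "(\<lambda>i. \<integral>\<omega>. (X \<omega> k - Y i \<omega> k)\<^sup>2 \<partial>M) \<longlonglongrightarrow> (\<integral>\<omega>. 0 \<partial>M)" if k: "k < n" for k
  proof (rule integral_dominated_convergence[where w = "\<lambda>\<omega>. 9 * (X \<omega> k)\<^sup>2"])
    have [measurable]: "(\<lambda>\<omega>. X \<omega> k) \<in> borel_measurable M" "s k i \<in> borel_measurable M" for i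
      using square_integrable_measurable[OF Xk[OF k]] meas[OF k] by auto
    show "(\<lambda>\<omega>. (X \<omega> k - Y i \<omega> k)\<^sup>2) \<in> borel_measurable M" for i
      using k unfolding Y_def by simp
    show "integrable M (\<lambda>\<omega>. 9 * (X \<omega> k)\<^sup>2)"
      by (intro integrable_mult_right square_integrable_power2 Xk k)
    show "AE \<omega> in M. (\<lambda>i. (X \<omega> k - Y i \<omega> k)\<^sup>2) \<longlonglongrightarrow> 0"
    proof (rule AE_I2)
      fix \<omega> assume "\<omega> \<in> space M"
      from tendsto_power[OF tendsto_diff[OF tendsto_const s(2)[OF k this]], of "X \<omega> k" 2]
      show "(\<lambda>i. (X \<omega> k - Y i \<omega> k)\<^sup>2) \<longlonglongrightarrow> 0" using k by (simp add: Y_def)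
    qed
    show "AE \<omega> in M. norm ((X \<omega> k - Y i \<omega> k)\<^sup>2) \<le> 9 * (X \<omega> k)\<^sup>2" for i
    proof (rule AE_I2)
      fix \<omega> assume "\<omega> \<in> space M"
      from s(3)[OF k this, of i] have "\<bar>X \<omega> k - s k i \<omega>\<bar> \<le> 3 * \<bar>X \<omega> k\<bar>" by linarith
      from power_mono[OF this, of 2] show "norm ((X \<omega> k - Y i \<omega> k)\<^sup>2) \<le> 9 * (X \<omega> k)\<^sup>2"
        using k by (simp add: Y_def power_mult_distrib)
    qed
  qed simp
  have "(\<lambda>i. \<Sum>k<n. \<integral>\<omega>. (X \<omega> k - Y i \<omega> k)\<^sup>2 \<partial>M) \<longlonglongrightarrow> (\<Sum>k<n. 0)"
    using lim by (intro tendsto_sum) auto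
  then have "(\<lambda>i. \<integral>\<omega>. sqnorm n (\<lambda>k. X \<omega> k - Y i \<omega> k) \<partial>M) \<longlonglongrightarrow> 0"
    by (simp add: integral_sqnorm[OF vec_square_integrable_diff[OF X Y]])
  then have "eventually (\<lambda>i. (\<integral>\<omega>. sqnorm n (\<lambda>k. X \<omega> k - Y i \<omega> k) \<partial>M) < e) sequentially"
    by (rule order_tendstoD) fact
  then obtain i where "(\<integral>\<omega>. sqnorm n (\<lambda>k. X \<omega> k - Y i \<omega> k) \<partial>M) < e"
    by (auto simp: eventually_sequentially)
  moreover have "simple_function M (Y i)"
    unfolding Y_def by (rule simple_function_vec) (rule s(1))
  ultimately show ?thesis using that Y by blast
qed

section \<open>Independent sums and averages\<close>

text \<open>Independent centred variables are pairwise orthogonal, so only the diagonal of the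
  double sum survives.\<close>

lemma (in prob_space) integral_power2_sum_indep:
  fixes Z :: "'b \<Rightarrow> 'a \<Rightarrow> real"
  assumes I: "finite I" and indep: "indep_vars (\<lambda>_. borel) Z I"
    and Z: "\<And>i. i \<in> I \<Longrightarrow> square_integrable M (Z i)"
    and mean: "\<And>i. i \<in> I \<Longrightarrow> (\<integral>\<omega>. Z i \<omega> \<partial>M) = 0"
  shows "(\<integral>\<omega>. (\<Sum>i\<in>I. Z i \<omega>)\<^sup>2 \<partial>M) = (\<Sum>i\<in>I. \<integral>\<omega>. (Z i \<omega>)\<^sup>2 \<partial>M)"
proof -
  have orth: "(\<integral>\<omega>. Z i \<omega> * Z j \<omega> \<partial>M) = 0" if "i \<in> I" "j \<in> I" "i \<noteq> j" for i j
  proof -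
    have "(\<integral>\<omega>. (\<Prod>k\<in>{i, j}. Z k \<omega>) \<partial>M) = (\<Prod>k\<in>{i, j}. \<integral>\<omega>. Z k \<omega> \<partial>M)"
      by (rule indep_vars_lebesgue_integral)
        (use that Z in \<open>auto intro: indep_vars_subset[OF indep] square_integrable_integrable\<close>)
    then show ?thesis using that by (simp add: mean)
  qed
  have "(\<integral>\<omega>. (\<Sum>i\<in>I. Z i \<omega>)\<^sup>2 \<partial>M) = (\<Sum>i\<in>I. \<Sum>j\<in>I. \<integral>\<omega>. Z i \<omega> * Z j \<omega> \<partial>M)"
    unfolding power2_eq_square sum_product
    by (simp add: Bochner_Integration.integral_sum Bochner_Integration.integrable_sum square_integrable_mult Z)
  also have "\<dots> = (\<Sum>i\<in>I. \<Sum>j\<in>I. if j = i then \<integral>\<omega>. (Z i \<omega>)\<^sup>2 \<partial>M else 0)"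
    by (intro sum.cong refl) (auto simp: orth power2_eq_square)
  finally show ?thesis using I by simp
qed

text \<open>Values centred at their average sum to zero, so a common shift \<open>b\<close> has no
  cross term with them.\<close>

lemma sum_power2_shift:
  fixes a :: "'b \<Rightarrow> real"
  assumes "finite I" "I \<noteq> {}"
  shows "(\<Sum>i\<in>I. (a i - (1 / real (card I)) * (\<Sum>i\<in>I. a i) + b)\<^sup>2) =
    (\<Sum>i\<in>I. (a i)\<^sup>2) - (\<Sum>i\<in>I. a i)\<^sup>2 / real (card I) + real (card I) * b\<^sup>2"
proof -
  define c where "c = b - (1 / real (card I)) * (\<Sum>i\<in>I. a i)"
  have "(\<Sum>i\<in>I. (a i - (1 / real (card I)) * (\<Sum>i\<in>I. a i) + b)\<^sup>2) = (\<Sum>i\<in>I. (a i + c)\<^sup>2)"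
    by (intro sum.cong refl) (simp add: c_def algebra_simps)
  also have "\<dots> = (\<Sum>i\<in>I. (a i)\<^sup>2) + real (card I) * c\<^sup>2 + 2 * c * (\<Sum>i\<in>I. a i)"
    unfolding power2_sum sum.distrib sum_distrib_left by (simp add: mult_ac)
  also have "\<dots> = (\<Sum>i\<in>I. (a i)\<^sup>2) - (\<Sum>i\<in>I. a i)\<^sup>2 / real (card I) + real (card I) * b\<^sup>2"
  proof -
    have "n * (b - (1 / n) * S)\<^sup>2 + 2 * (b - (1 / n) * S) * S = n * b\<^sup>2 - S\<^sup>2 / n"
      if "n \<noteq> 0" for n S :: real
      using that by (simp add: field_simps power2_eq_square)
    from this[of "real (card I)" "\<Sum>i\<in>I. a i"] show ?thesis
      using assms unfolding c_def by simp
  qed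
  finally show ?thesis .
qed

text \<open>Jensen's inequality for the uniform average: the left-hand side of the preceding
  identity is nonnegative at \<open>b = 0\<close>.\<close>

lemma power2_mean_le:
  fixes a :: "'b \<Rightarrow> real"
  assumes "finite I" "I \<noteq> {}"
  shows "((1 / real (card I)) * (\<Sum>i\<in>I. a i))\<^sup>2 \<le> (1 / real (card I)) * (\<Sum>i\<in>I. (a i)\<^sup>2)"
proof -
  have "0 \<le> (\<Sum>i\<in>I. (a i - (1 / real (card I)) * (\<Sum>i\<in>I. a i) + 0)\<^sup>2)"
    by (intro sum_nonneg) simp
  then have "(\<Sum>i\<in>I. a i)\<^sup>2 / real (card I) \<le> (\<Sum>i\<in>I. (a i)\<^sup>2)"
    unfolding sum_power2_shift[OF assms] by simp
  from mult_left_mono[OF this, of "1 / real (card I)"] show ?thesis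
    by (simp add: power2_eq_square)
qed

text \<open>Optimising over \<open>t\<close> turns Young's inequality into Minkowski's.\<close>

lemma power2_sqrt_add_ge:
  fixes a b x :: real
  assumes "0 \<le> a" "0 \<le> b" and le: "\<And>t. t > 0 \<Longrightarrow> x \<le> (1 + t) * a + (1 + 1 / t) * b"
  shows "x \<le> (sqrt a + sqrt b)\<^sup>2"
proof (rule field_le_epsilon)
  fix e :: real assume "e > 0"
  \<comment> \<open>The optimal \<open>t\<close> is \<open>sqrt b / sqrt a\<close>. Adding
    \<open>d\<close> to both roots keeps it positive and well defined when \<open>a\<close> or
    \<open>b\<close> is zero, and the price \<open>d * (sqrt a + sqrt b)\<close> is at most
    \<open>e\<close>.\<close>
  define d where "d = e / (sqrt a + sqrt b + 1)"
  have s: "sqrt a + sqrt b + 1 > 0" using assms by (simp add: add_nonneg_pos)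
  then have d: "d > 0" using \<open>e > 0\<close> by (simp add: d_def)
  let ?t = "(sqrt b + d) / (sqrt a + d)"
  have pos: "sqrt a + d > 0" "sqrt b + d > 0" using assms d by (simp_all add: add_nonneg_pos)
  have "?t * a = (sqrt b + d) * sqrt a * (sqrt a / (sqrt a + d))"
    using assms by (simp add: mult.assoc)
  also have "\<dots> \<le> (sqrt b + d) * sqrt a * 1"
    using assms d pos by (intro mult_left_mono) (auto simp: field_simps)
  finally have 1: "?t * a \<le> (sqrt b + d) * sqrt a" by simp
  have "1 / ?t * b = (sqrt a + d) * sqrt b * (sqrt b / (sqrt b + d))"
    using assms by (simp add: mult.assoc)
  also have "\<dots> \<le> (sqrt a + d) * sqrt b * 1"
    using assms d pos by (intro mult_left_mono) (auto simp: field_simps)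
  finally have 2: "1 / ?t * b \<le> (sqrt a + d) * sqrt b" by simp
  have "x \<le> a + ?t * a + (b + 1 / ?t * b)"
    using le[of ?t] pos by (simp add: algebra_simps)
  also have "\<dots> \<le> a + (sqrt b + d) * sqrt a + (b + (sqrt a + d) * sqrt b)"
    using 1 2 by linarith
  also have "\<dots> = (sqrt a + sqrt b)\<^sup>2 + d * (sqrt a + sqrt b)"
    using assms by (simp add: power2_sum algebra_simps)
  also have "d * (sqrt a + sqrt b) \<le> e"
    using s \<open>e > 0\<close> by (simp add: d_def field_simps)
  finally show "x \<le> (sqrt a + sqrt b)\<^sup>2 + e" by simp
qed

section \<open>Energy decay of the expected layers\<close>

text \<open>The centring vectors \<open>c\<close> are a parameter: once the means, which depend on
  the law of the whole input, are frozen, a layer is a deterministic map of a single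
  realisation.\<close>

fun scatter :: "(nat \<Rightarrow> nat) \<Rightarrow> (nat \<Rightarrow> nat \<Rightarrow> nat \<Rightarrow> complex) \<Rightarrow> (nat \<Rightarrow> nat \<Rightarrow> real)
    \<Rightarrow> nat \<Rightarrow> (nat \<Rightarrow> real) \<Rightarrow> nat \<Rightarrow> real" where
  "scatter Ns W c 0 x = x"
| "scatter Ns W c (Suc m) x = (\<lambda>j. cmod (applyW (W (Suc m)) (Ns m) (Ns (Suc m))
      (\<lambda>k. scatter Ns W c m x k - c m k) j))"

lemma layer_eq_scatter:
  "layer M Ns W X m \<omega> = scatter Ns W (\<lambda>m k. \<integral>\<omega>'. layer M Ns W X m \<omega>' k \<partial>M) m (X \<omega>)"
  by (induction m) simp_all

text \<open>Measurability on the function space lets equality in law and independence of the inputs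
  pass to layers with fixed centrings.\<close>

lemma measurable_scatter_component:
  "(\<lambda>x. scatter Ns W c m x k) \<in> borel_measurable borel"
proof (induction m arbitrary: k)
  case 0
  show ?case by simp
next
  case (Suc m)
  then show ?case by (auto intro!: measurable_cmod_applyW)
qed

locale scattering = prob_space M for M :: "'a measure" +
  fixes Ns :: "nat \<Rightarrow> nat" and W :: "nat \<Rightarrow> nat \<Rightarrow> nat \<Rightarrow> complex"
  assumes isometry: "\<And>m. adj_isometry (W (Suc m)) (Ns m) (Ns (Suc m))"
begin

text \<open>The input is an argument, not fixed by the locale, since the approximation argument
  compares the layers of two different inputs.\<close>

definition mean :: "('a \<Rightarrow> nat \<Rightarrow> real) \<Rightarrow> nat \<Rightarrow> nat \<Rightarrow> real" where
  "mean X m k = (\<integral>\<omega>. layer M Ns W X m \<omega> k \<partial>M)"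

definition var :: "('a \<Rightarrow> nat \<Rightarrow> real) \<Rightarrow> nat \<Rightarrow> real" where
  "var X m = (\<integral>\<omega>. sqnorm (Ns m) (\<lambda>k. layer M Ns W X m \<omega> k - mean X m k) \<partial>M)"

lemma var_nonneg: "0 \<le> var X m"
  unfolding var_def by (intro integral_nonneg_AE) (simp add: sqnorm_nonneg)

lemma layer_eq_scatter_mean: "layer M Ns W X m \<omega> = scatter Ns W (mean X) m (X \<omega>)"
  unfolding mean_def by (rule layer_eq_scatter)

lemma vec_square_integrable_layer:
  assumes "vec_square_integrable M (Ns 0) X"
  shows "vec_square_integrable M (Ns m) (layer M Ns W X m)"
proof (induction m)
  case 0
  show ?case using assms by simp
next
  case (Suc m)
  then show ?case
    by (auto intro!: vec_square_integrable_cmod_applyW isometry vec_square_integrable_diff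
      vec_square_integrable_const)
qed

lemma vec_square_integrable_layer_centred:
  assumes "vec_square_integrable M (Ns 0) X"
  shows "vec_square_integrable M (Ns m) (\<lambda>\<omega> k. layer M Ns W X m \<omega> k - c k)"
  by (intro vec_square_integrable_diff vec_square_integrable_layer vec_square_integrable_const assms)

section \<open>Energy balance between consecutive layers\<close>

lemma energy_eq_var_plus_mean:
  assumes "vec_square_integrable M (Ns 0) X"
  shows "(\<integral>\<omega>. sqnorm (Ns m) (layer M Ns W X m \<omega>) \<partial>M) = var X m + sqnorm (Ns m) (mean X m)"
  unfolding var_def mean_def
  by (rule integral_sqnorm_mean[OF vec_square_integrable_layer[OF assms]])

text \<open>The isometry preserves the norm of every centred realisation, and taking moduli does not
  change it.\<close>

lemma energy_Suc: "(\<integral>\<omega>. sqnorm (Ns (Suc m)) (layer M Ns W X (Suc m) \<omega>) \<partial>M) = var X m"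
  by (simp add: sqnorm_cmod_applyW[OF isometry] var_def mean_def)

text \<open>The energy of layer \<open>Suc m\<close> is evaluated in two ways: as the preceding
  variance, and as its own variance plus squared mean.\<close>

lemma var_eq:
  assumes "vec_square_integrable M (Ns 0) X"
  shows "var X m = var X (Suc m) + sqnorm (Ns (Suc m)) (mean X (Suc m))"
  using energy_eq_var_plus_mean[OF assms, of "Suc m"] energy_Suc[of m X] by simp

lemma var_le_energy:
  assumes "vec_square_integrable M (Ns 0) X"
  shows "var X m \<le> (\<integral>\<omega>. sqnorm (Ns 0) (X \<omega>) \<partial>M)"
proof (induction m)
  case 0
  show ?case using energy_eq_var_plus_mean[OF assms, of 0] by (simp add: sqnorm_nonneg)
next
  case (Suc m)
  then show ?case using var_eq[OF assms, of m] sqnorm_nonneg[of "Ns (Suc m)" "mean X (Suc m)"] by linarith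
qed

text \<open>Centring each layer at its own mean amounts to centring the difference of the two
  layers, which cannot increase its mean square; the modulus of an isometric map is
  nonexpansive.\<close>

lemma layer_contraction:
  assumes X: "vec_square_integrable M (Ns 0) X" and Y: "vec_square_integrable M (Ns 0) Y"
  shows "(\<integral>\<omega>. sqnorm (Ns m) (\<lambda>k. layer M Ns W X m \<omega> k - layer M Ns W Y m \<omega> k) \<partial>M) \<le>
    (\<integral>\<omega>. sqnorm (Ns 0) (\<lambda>k. X \<omega> k - Y \<omega> k) \<partial>M)"
proof (induction m)
  case 0
  show ?case by simp
next
  case (Suc m)
  let ?D = "\<lambda>m \<omega> k. layer M Ns W X m \<omega> k - layer M Ns W Y m \<omega> k"
  have D: "vec_square_integrable M (Ns m) (?D m)" for m
    by (intro vec_square_integrable_diff vec_square_integrable_layer X Y)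
  have mean: "(\<integral>\<omega>'. ?D m \<omega>' k \<partial>M) = mean X m k - mean Y m k" if "k < Ns m" for k
    unfolding mean_def
    using vec_square_integrable_layer[OF X, of m] vec_square_integrable_layer[OF Y, of m] that
    by (auto simp: vec_square_integrable_def square_integrable_integrable)
  have "sqnorm (Ns (Suc m)) (?D (Suc m) \<omega>) \<le> sqnorm (Ns m) (\<lambda>k. ?D m \<omega> k - (\<integral>\<omega>'. ?D m \<omega>' k \<partial>M))" for \<omega>
  proof -
    have "sqnorm (Ns (Suc m)) (?D (Suc m) \<omega>) \<le>
      sqnorm (Ns m) (\<lambda>k. (layer M Ns W X m \<omega> k - mean X m k) - (layer M Ns W Y m \<omega> k - mean Y m k))"
      unfolding layer.simps mean_def by (rule sqnorm_cmod_applyW_diff_le[OF isometry])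
    also have "\<dots> = sqnorm (Ns m) (\<lambda>k. ?D m \<omega> k - (\<integral>\<omega>'. ?D m \<omega>' k \<partial>M))"
      unfolding sqnorm_def by (intro sum.cong refl) (simp add: mean algebra_simps)
    finally show ?thesis .
  qed
  then have "(\<integral>\<omega>. sqnorm (Ns (Suc m)) (?D (Suc m) \<omega>) \<partial>M) \<le>
      (\<integral>\<omega>. sqnorm (Ns m) (\<lambda>k. ?D m \<omega> k - (\<integral>\<omega>'. ?D m \<omega>' k \<partial>M)) \<partial>M)"
    by (intro integral_mono integrable_sqnorm D vec_square_integrable_diff vec_square_integrable_const)
  also have "\<dots> \<le> (\<integral>\<omega>. sqnorm (Ns m) (?D m \<omega>) \<partial>M)"
    using integral_sqnorm_centre_le[OF D, of m "\<lambda>_. 0"] by simp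
  finally show ?case using Suc.IH by linarith
qed

text \<open>By \<open>var_eq\<close> each squared mean is a drop of the variance, so the sum
  telescopes.\<close>

lemma mean_energy_partial_sums:
  assumes "vec_square_integrable M (Ns 0) X"
  shows "(\<Sum>k<K. sqnorm (Ns (Suc (k + n))) (mean X (Suc (k + n)))) = var X n - var X (K + n)"
proof (induction K)
  case (Suc K)
  then show ?case using var_eq[OF assms, of "K + n"] by simp
qed simp

lemma summable_mean_energy:
  assumes "vec_square_integrable M (Ns 0) X"
  shows "summable (\<lambda>k. sqnorm (Ns (Suc (k + n))) (mean X (Suc (k + n))))"
  by (rule summableI_nonneg_bounded[where x = "var X n"])
    (simp_all add: sqnorm_nonneg mean_energy_partial_sums[OF assms] var_nonneg)

text \<open>For a random vector with finitely many values, every value of positive probability has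
  probability at least some \<open>p > 0\<close>; as the layers \<open>m \<ge> 1\<close> are nonnegative, their means dominate
  \<open>p\<close> times almost every realisation.\<close>

lemma var_tendsto_0_simple:
  assumes simp: "simple_function M X" and X: "vec_square_integrable M (Ns 0) X"
  shows "var X \<longlonglongrightarrow> 0"
proof -
  \<comment> \<open>Values of probability zero are left out, as they would spoil the positive lower
    bound \<open>p\<close>.\<close>
  define V where "V = {v \<in> X ` space M. prob (X -` {v} \<inter> space M) > 0}"
  have finV: "finite V" and [measurable]: "X -` {v} \<inter> space M \<in> events" for v
    using simp by (auto simp: V_def simple_function_def intro: simple_functionD)
  obtain p where p: "p > 0" "\<And>v. v \<in> V \<Longrightarrow> p \<le> prob (X -` {v} \<inter> space M)"
  proof (cases "V = {}")
    \<comment> \<open>The bound is vacuous here, so 1 is an arbitrary positive choice.\<close>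
    case True
    then show ?thesis using that[of 1] by simp
  next
    case False
    let ?S = "(\<lambda>v. prob (X -` {v} \<inter> space M)) ` V"
    have "Min ?S \<in> ?S" using False finV by (intro Min_in) auto
    then have "Min ?S > 0" by (auto simp: V_def)
    then show ?thesis using that[of "Min ?S"] finV by auto
  qed
  \<comment> \<open>The values left out are finitely many, and each is taken on a null set.\<close>
  have AE_V: "AE \<omega> in M. X \<omega> \<in> V"
  proof -
    have "AE \<omega> in M. \<forall>v \<in> X ` space M - V. X \<omega> \<noteq> v"
    proof (rule AE_finite_allI)
      show "finite (X ` space M - V)" using simp by (simp add: simple_function_def)
      fix v assume "v \<in> X ` space M - V"
      then have "prob (X -` {v} \<inter> space M) = 0"
        by (auto simp: V_def not_less intro!: antisym)
      then have "X -` {v} \<inter> space M \<in> null_sets M"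
        by (auto simp: null_sets_def emeasure_eq_measure)
      then show "AE \<omega> in M. X \<omega> \<noteq> v"
        by (rule AE_I') auto
    qed
    then show ?thesis by (rule AE_mp) (auto intro!: AE_I2)
  qed
  have bound: "p * scatter Ns W (mean X) (Suc m) v j \<le> mean X (Suc m) j"
    if "v \<in> V" "j < Ns (Suc m)" for v m j
  proof -
    let ?s = "scatter Ns W (mean X) (Suc m)"
    have int: "integrable M (\<lambda>\<omega>. ?s (X \<omega>) j)"
      using vec_square_integrable_layer[OF X, of "Suc m"] that
      unfolding layer_eq_scatter_mean vec_square_integrable_def
      by (auto intro: square_integrable_integrable)
    have "p * ?s v j \<le> prob (X -` {v} \<inter> space M) * ?s v j"
      using p(2)[OF that(1)] by (intro mult_right_mono) auto
    also have "\<dots> = (\<integral>\<omega>. indicator (X -` {v} \<inter> space M) \<omega> * ?s v j \<partial>M)"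
      by simp
    \<comment> \<open>On the event that \<open>X\<close> equals \<open>v\<close> both integrands
      agree, because \<open>scatter\<close> sees only the realisation; elsewhere the right one is a
      modulus, hence nonnegative.\<close>
    also have "\<dots> \<le> (\<integral>\<omega>. ?s (X \<omega>) j \<partial>M)"
    proof (rule integral_mono)
      show "integrable M (\<lambda>\<omega>. indicator (X -` {v} \<inter> space M) \<omega> * ?s v j)"
        by (intro integrable_mult_left) (simp add: emeasure_eq_measure)
      show "indicator (X -` {v} \<inter> space M) \<omega> * ?s v j \<le> ?s (X \<omega>) j" for \<omega>
        by (auto split: split_indicator)
    qed (fact int)
    finally show ?thesis
      unfolding mean_def[of X "Suc m"] layer_eq_scatter_mean .
  qed
  \<comment> \<open>Squaring \<open>bound\<close> and summing over coordinates compares the energy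
    of layer \<open>Suc m\<close>, which is \<open>var X m\<close>, with its squared mean.\<close>
  have le: "p\<^sup>2 * var X m \<le> sqnorm (Ns (Suc m)) (mean X (Suc m))" for m
  proof -
    have "AE \<omega> in M. p\<^sup>2 * sqnorm (Ns (Suc m)) (layer M Ns W X (Suc m) \<omega>) \<le>
        sqnorm (Ns (Suc m)) (mean X (Suc m))"
      using AE_V
    proof eventually_elim
      case (elim \<omega>)
      show ?case
        unfolding layer_eq_scatter_mean sqnorm_def sum_distrib_left power_mult_distrib[symmetric]
        using p(1) elim by (intro sum_mono power_mono bound) auto
    qed
    then have "(\<integral>\<omega>. p\<^sup>2 * sqnorm (Ns (Suc m)) (layer M Ns W X (Suc m) \<omega>) \<partial>M) \<le>
        (\<integral>\<omega>. sqnorm (Ns (Suc m)) (mean X (Suc m)) \<partial>M)"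
      by (intro integral_mono_AE integrable_mult_right integrable_sqnorm
        vec_square_integrable_layer vec_square_integrable_const X) auto
    then show ?thesis
      unfolding integral_mult_right_zero energy_Suc by (simp add: prob_space)
  qed
  \<comment> \<open>The squared means are the terms of a convergent series.\<close>
  have lim: "(\<lambda>m. sqnorm (Ns (Suc m)) (mean X (Suc m)) / p\<^sup>2) \<longlonglongrightarrow> 0"
    using tendsto_divide[OF summable_LIMSEQ_zero[OF summable_mean_energy[OF X, of 0]] tendsto_const,
      of "p\<^sup>2"] p(1) by simp
  have "var X m \<le> sqnorm (Ns (Suc m)) (mean X (Suc m)) / p\<^sup>2" for m
    using le[of m] p(1) by (simp add: field_simps)
  then show ?thesis
    by (intro tendsto_sandwich[OF _ _ tendsto_const lim] always_eventually allI var_nonneg)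
qed

section \<open>From finitely valued to general inputs\<close>

text \<open>Centring the layer of \<open>X\<close> at the mean belonging to \<open>Y\<close> only
  increases the mean square; the layer of \<open>Y\<close> is then inserted, and
  \<open>layer_contraction\<close> controls the difference.\<close>

lemma var_le_approx:
  assumes X: "vec_square_integrable M (Ns 0) X" and Y: "vec_square_integrable M (Ns 0) Y"
  shows "var X m \<le> 2 * (\<integral>\<omega>. sqnorm (Ns 0) (\<lambda>k. X \<omega> k - Y \<omega> k) \<partial>M) + 2 * var Y m"
proof -
  let ?L = "layer M Ns W X m" and ?K = "layer M Ns W Y m"
  have L: "vec_square_integrable M (Ns m) ?L" and K: "vec_square_integrable M (Ns m) ?K"
    by (intro vec_square_integrable_layer X Y)+
  have D: "vec_square_integrable M (Ns m) (\<lambda>\<omega> k. ?L \<omega> k - ?K \<omega> k)"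
    by (intro vec_square_integrable_diff L K)
  note C = vec_square_integrable_layer_centred[OF X, of m "mean Y m"]
    vec_square_integrable_layer_centred[OF Y, of m "mean Y m"]
  have "var X m \<le> (\<integral>\<omega>. sqnorm (Ns m) (\<lambda>k. ?L \<omega> k - mean Y m k) \<partial>M)"
    unfolding var_def mean_def[of X] by (rule integral_sqnorm_centre_le[OF L])
  also have "\<dots> \<le> (\<integral>\<omega>. 2 * sqnorm (Ns m) (\<lambda>k. ?L \<omega> k - ?K \<omega> k) +
      2 * sqnorm (Ns m) (\<lambda>k. ?K \<omega> k - mean Y m k) \<partial>M)"
  proof (rule integral_mono)
    fix \<omega>
    have "sqnorm (Ns m) (\<lambda>k. mean Y m k - ?K \<omega> k) = sqnorm (Ns m) (\<lambda>k. ?K \<omega> k - mean Y m k)"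
      by (simp add: sqnorm_def power2_commute)
    then show "sqnorm (Ns m) (\<lambda>k. ?L \<omega> k - mean Y m k) \<le> 2 * sqnorm (Ns m) (\<lambda>k. ?L \<omega> k - ?K \<omega> k) +
      2 * sqnorm (Ns m) (\<lambda>k. ?K \<omega> k - mean Y m k)"
      using sqnorm_diff_le[of "Ns m" "\<lambda>k. ?L \<omega> k - ?K \<omega> k" "\<lambda>k. mean Y m k - ?K \<omega> k"] by simp
  qed (intro Bochner_Integration.integrable_add integrable_mult_right integrable_sqnorm C D)+
  also have "\<dots> = 2 * (\<integral>\<omega>. sqnorm (Ns m) (\<lambda>k. ?L \<omega> k - ?K \<omega> k) \<partial>M) + 2 * var Y m"
    unfolding var_def by (simp add: integrable_sqnorm C D)
  finally show ?thesis using layer_contraction[OF X Y, of m] by linarith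
qed

lemma var_tendsto_0:
  assumes X: "vec_square_integrable M (Ns 0) X"
  shows "var X \<longlonglongrightarrow> 0"
proof (rule order_tendstoI)
  show "eventually (\<lambda>m. a < var X m) sequentially" if "a < 0" for a
    using that var_nonneg[of X] by (intro always_eventually) (auto intro: less_le_trans)
  \<comment> \<open>The approximation error and the variance of \<open>Y\<close> each enter
    \<open>var_le_approx\<close> with factor 2, hence \<open>e / 4\<close>.\<close>
  fix e :: real assume "e > 0"
  then obtain Y where Y: "simple_function M Y" "vec_square_integrable M (Ns 0) Y"
      "(\<integral>\<omega>. sqnorm (Ns 0) (\<lambda>k. X \<omega> k - Y \<omega> k) \<partial>M) < e / 4"
    using vec_square_integrable_simple_approx[OF X, of "e / 4"] by auto
  have "eventually (\<lambda>m. var Y m < e / 4) sequentially"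
    using \<open>e > 0\<close> by (intro order_tendstoD(2)[OF var_tendsto_0_simple[OF Y(1,2)]]) simp
  then show "eventually (\<lambda>m. var X m < e) sequentially"
  proof eventually_elim
    case (elim m)
    then show ?case using var_le_approx[OF X Y(2), of m] Y(3) by linarith
  qed
qed

text \<open>As the remaining variance tends to 0, the telescoping sum exhausts
  \<open>var X n\<close>; this identifies the inner series of the bound.\<close>

lemma mean_energy_sums:
  assumes "vec_square_integrable M (Ns 0) X"
  shows "(\<lambda>k. sqnorm (Ns (Suc (k + n))) (mean X (Suc (k + n)))) sums var X n"
  unfolding sums_def mean_energy_partial_sums[OF assms]
  using tendsto_diff[OF tendsto_const LIMSEQ_ignore_initial_segment[OF var_tendsto_0[OF assms], of n]]
  by simp

end

section \<open>Empirical layers\<close>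

locale scattering_sample = scattering M Ns W for M :: "'a measure" and Ns W +
  fixes X :: "'a \<Rightarrow> nat \<Rightarrow> real" and Xp :: "nat \<Rightarrow> 'a \<Rightarrow> nat \<Rightarrow> real" and P :: nat
  assumes X_measurable: "X \<in> borel_measurable M"
    and X_square_integrable: "vec_square_integrable M (Ns 0) X"
    and P_pos: "P \<ge> 1"
    and Xp_measurable: "\<And>i. i \<in> {1..P} \<Longrightarrow> Xp i \<in> borel_measurable M"
    and Xp_indep: "indep_vars (\<lambda>_. borel) Xp {1..P}"
    and Xp_distr: "\<And>i. i \<in> {1..P} \<Longrightarrow> distr M borel (Xp i) = distr M borel X"
begin

text \<open>The samples propagated with the true means instead of the empirical ones; these are i.i.d.\<close>

definition sample :: "nat \<Rightarrow> nat \<Rightarrow> 'a \<Rightarrow> nat \<Rightarrow> real" where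
  "sample m i \<omega> = scatter Ns W (mean X) m (Xp i \<omega>)"

abbreviation emp :: "nat \<Rightarrow> nat \<Rightarrow> 'a \<Rightarrow> nat \<Rightarrow> real" where
  "emp \<equiv> emp_layer Ns W P Xp"

text \<open>The sign, true mean minus average, is the one with which the error enters the centred
  empirical layers in \<open>deviation_Suc_le\<close>.\<close>

definition mean_error :: "nat \<Rightarrow> 'a \<Rightarrow> nat \<Rightarrow> real" where
  "mean_error m \<omega> k = mean X m k - (1 / real P) * (\<Sum>i=1..P. sample m i \<omega> k)"

text \<open>This is \<open>D\<^sub>m\<close>. With an average over the samples, subtracting the
  empirical mean acts as an orthogonal projection.\<close>

definition deviation :: "nat \<Rightarrow> real" where
  "deviation m = (\<integral>\<omega>. (1 / real P) * (\<Sum>i=1..P. sqnorm (Ns m) (\<lambda>k. emp m i \<omega> k - sample m i \<omega> k)) \<partial>M)"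

section \<open>Samples propagated with the true means\<close>

text \<open>Change of variables through the common law of \<open>Xp i\<close> and
  \<open>X\<close>.\<close>

lemma Xp_transfer:
  fixes f :: "(nat \<Rightarrow> real) \<Rightarrow> real"
  assumes "i \<in> {1..P}" and f: "f \<in> borel_measurable borel"
  shows "integrable M (\<lambda>\<omega>. f (Xp i \<omega>)) \<longleftrightarrow> integrable M (\<lambda>\<omega>. f (X \<omega>))"
    and "(\<integral>\<omega>. f (Xp i \<omega>) \<partial>M) = (\<integral>\<omega>. f (X \<omega>) \<partial>M)"
  using integrable_distr_eq[OF Xp_measurable f] integrable_distr_eq[OF X_measurable f]
    integral_distr[OF Xp_measurable f] integral_distr[OF X_measurable f] assms Xp_distr
  by simp_all

lemma square_integrable_sample:
  assumes "i \<in> {1..P}" "k < Ns m"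
  shows "square_integrable M (\<lambda>\<omega>. sample m i \<omega> k)"
proof -
  note f = measurable_scatter_component[of Ns W "mean X" m k]
  have "square_integrable M (\<lambda>\<omega>. scatter Ns W (mean X) m (X \<omega>) k)"
    using vec_square_integrable_layer[OF X_square_integrable, of m] assms
    unfolding vec_square_integrable_def layer_eq_scatter_mean by blast
  then have "integrable M (\<lambda>\<omega>. (sample m i \<omega> k)\<^sup>2)"
    unfolding sample_def using f
    by (subst Xp_transfer(1)[OF assms(1), of "\<lambda>x. (scatter Ns W (mean X) m x k)\<^sup>2"])
      (auto simp: square_integrable_def)
  then show ?thesis
    unfolding square_integrable_def sample_def using measurable_compose[OF Xp_measurable[OF assms(1)] f]
    by simp
qed

lemma vec_square_integrable_sample:
  "i \<in> {1..P} \<Longrightarrow> vec_square_integrable M (Ns m) (sample m i)"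
  unfolding vec_square_integrable_def by (blast intro: square_integrable_sample)

lemma expectation_sample: "i \<in> {1..P} \<Longrightarrow> (\<integral>\<omega>. sample m i \<omega> k \<partial>M) = mean X m k"
  unfolding sample_def mean_def[of X m k] layer_eq_scatter_mean
  by (rule Xp_transfer(2)[OF _ measurable_scatter_component])

lemma vec_square_integrable_mean_error: "vec_square_integrable M (Ns m) (mean_error m)"
  unfolding vec_square_integrable_def mean_error_def
  by (intro allI impI square_integrable_diff square_integrable_const square_integrable_cmult
    square_integrable_sum square_integrable_sample)

text \<open>The variance of an average of independent copies, taken coordinatewise: independence is
  across samples, while the coordinates of one sample may be correlated.\<close>

lemma integral_sqnorm_mean_error:
  "(\<integral>\<omega>. sqnorm (Ns m) (mean_error m \<omega>) \<partial>M) = var X m / real P"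
proof -
  have "(\<integral>\<omega>. (mean_error m \<omega> k)\<^sup>2 \<partial>M) = (\<integral>\<omega>. (layer M Ns W X m \<omega> k - mean X m k)\<^sup>2 \<partial>M) / real P"
    if k: "k < Ns m" for k
  proof -
    let ?g = "\<lambda>x. scatter Ns W (mean X) m x k - mean X m k"
    have g: "?g \<in> borel_measurable borel"
      using measurable_scatter_component by measurable
    \<comment> \<open>The error is minus the average of these centred variables, which are
      independent because each is a fixed function of one sample.\<close>
    define Z where "Z i \<omega> = sample m i \<omega> k - mean X m k" for i \<omega>
    have "mean_error m \<omega> k = - ((\<Sum>i=1..P. Z i \<omega>) / real P)" for \<omega>
      using P_pos by (simp add: mean_error_def Z_def sum_subtractf field_simps)
    then have "(\<integral>\<omega>. (mean_error m \<omega> k)\<^sup>2 \<partial>M) = (\<integral>\<omega>. (\<Sum>i=1..P. Z i \<omega>)\<^sup>2 \<partial>M) / (real P)\<^sup>2"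
      by (simp add: power_divide)
    also have "(\<integral>\<omega>. (\<Sum>i=1..P. Z i \<omega>)\<^sup>2 \<partial>M) = (\<Sum>i=1..P. \<integral>\<omega>. (Z i \<omega>)\<^sup>2 \<partial>M)"
    proof (rule integral_power2_sum_indep)
      show "indep_vars (\<lambda>_. borel) Z {1..P}"
        unfolding Z_def sample_def
        by (rule indep_vars_compose2[OF Xp_indep, where Y = "\<lambda>_. ?g"]) (rule g)
      show "square_integrable M (Z i)" if "i \<in> {1..P}" for i
        unfolding Z_def using that k
        by (intro square_integrable_diff square_integrable_sample square_integrable_const)
      show "(\<integral>\<omega>. Z i \<omega> \<partial>M) = 0" if "i \<in> {1..P}" for i
        unfolding Z_def using square_integrable_integrable[OF square_integrable_sample[OF that k]]
          expectation_sample[OF that]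
        by (simp add: prob_space)
    qed simp
    also have "\<dots> = (\<Sum>i=1..P. \<integral>\<omega>. (layer M Ns W X m \<omega> k - mean X m k)\<^sup>2 \<partial>M)"
      unfolding Z_def sample_def layer_eq_scatter_mean using g
      by (intro sum.cong refl Xp_transfer(2)[where f = "\<lambda>x. (?g x)\<^sup>2"]) auto
    finally show ?thesis using P_pos by (simp add: power2_eq_square)
  qed
  then show ?thesis
    unfolding var_def
    by (simp add: integral_sqnorm vec_square_integrable_mean_error X_square_integrable
      vec_square_integrable_layer_centred sum_divide_distrib)
qed

text \<open>The index \<open>i\<close> is generalised in the induction because the next layer of one
  sample involves the empirical mean of all of them.\<close>

lemma vec_square_integrable_emp:
  "i \<in> {1..P} \<Longrightarrow> vec_square_integrable M (Ns m) (emp m i)"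
proof (induction m arbitrary: i)
  case 0
  then show ?case using vec_square_integrable_sample[of i 0]
    by (simp add: vec_square_integrable_def sample_def)
next
  case (Suc m)
  have "vec_square_integrable M (Ns m) (\<lambda>\<omega> k. (1 / real P) * (\<Sum>i'=1..P. emp m i' \<omega> k))"
    unfolding vec_square_integrable_def using Suc.IH
    by (intro allI impI square_integrable_cmult square_integrable_sum) (simp add: vec_square_integrable_def)
  then show ?case unfolding emp_layer.simps
    by (intro vec_square_integrable_cmod_applyW isometry vec_square_integrable_diff Suc)
qed

lemma integrable_deviation:
  "integrable M (\<lambda>\<omega>. (1 / real P) * (\<Sum>i=1..P. sqnorm (Ns m) (\<lambda>k. emp m i \<omega> k - sample m i \<omega> k)))"
  by (intro integrable_mult_right Bochner_Integration.integrable_sum integrable_sqnorm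
    vec_square_integrable_diff vec_square_integrable_emp vec_square_integrable_sample)

lemma deviation_nonneg: "0 \<le> deviation m"
  unfolding deviation_def by (intro integral_nonneg_AE AE_I2) (simp add: sum_nonneg sqnorm_nonneg)

lemma deviation_0: "deviation 0 = 0"
  by (simp add: deviation_def sample_def sqnorm_def)

text \<open>Centring the deviations and adding the error of the mean are orthogonal operations, so the
  two contributions add up in the squared norm.\<close>

lemma deviation_Suc_le: "deviation (Suc m) \<le> deviation m + var X m / real P"
proof -
  let ?I = "{1..P}"
  let ?d = "\<lambda>m \<omega>. (1 / real P) * (\<Sum>i\<in>?I. sqnorm (Ns m) (\<lambda>k. emp m i \<omega> k - sample m i \<omega> k))"
  have "?d (Suc m) \<omega> \<le> ?d m \<omega> + sqnorm (Ns m) (mean_error m \<omega>)" for \<omega>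
  proof -
    let ?a = "\<lambda>i k. emp m i \<omega> k - sample m i \<omega> k"
    have "(\<Sum>i\<in>?I. sqnorm (Ns (Suc m)) (\<lambda>k. emp (Suc m) i \<omega> k - sample (Suc m) i \<omega> k)) \<le>
        (\<Sum>i\<in>?I. sqnorm (Ns m) (\<lambda>k. (emp m i \<omega> k - (1 / real P) * (\<Sum>i'\<in>?I. emp m i' \<omega> k)) -
          (sample m i \<omega> k - mean X m k)))"
      unfolding emp_layer.simps sample_def scatter.simps
      by (intro sum_mono sqnorm_cmod_applyW_diff_le isometry)
    \<comment> \<open>Writing the empirical layers as samples plus deviations moves the average of
      the samples into \<open>mean_error\<close>.\<close>
    also have "\<dots> = (\<Sum>i\<in>?I. sqnorm (Ns m) (\<lambda>k. ?a i k - (1 / real (card ?I)) * (\<Sum>i\<in>?I. ?a i k) +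
        mean_error m \<omega> k))"
      by (simp add: mean_error_def sum_subtractf algebra_simps diff_divide_distrib)
    also have "\<dots> = (\<Sum>k<Ns m. \<Sum>i\<in>?I. (?a i k - (1 / real (card ?I)) * (\<Sum>i\<in>?I. ?a i k) + mean_error m \<omega> k)\<^sup>2)"
      unfolding sqnorm_def by (rule sum.swap)
    \<comment> \<open>The identity \<open>sum_power2_shift\<close> also yields a nonpositive term
      from the average of the deviations, which is dropped.\<close>
    also have "\<dots> \<le> (\<Sum>k<Ns m. (\<Sum>i\<in>?I. (?a i k)\<^sup>2) + real P * (mean_error m \<omega> k)\<^sup>2)"
    proof (rule sum_mono)
      fix k
      show "(\<Sum>i\<in>?I. (?a i k - (1 / real (card ?I)) * (\<Sum>i\<in>?I. ?a i k) + mean_error m \<omega> k)\<^sup>2) \<le>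
          (\<Sum>i\<in>?I. (?a i k)\<^sup>2) + real P * (mean_error m \<omega> k)\<^sup>2"
        using P_pos by (subst sum_power2_shift) auto
    qed
    also have "\<dots> = (\<Sum>i\<in>?I. sqnorm (Ns m) (?a i)) + real P * sqnorm (Ns m) (mean_error m \<omega>)"
      unfolding sqnorm_def sum.distrib sum_distrib_left by (subst sum.swap) simp
    finally show ?thesis using P_pos by (simp add: field_simps)
  qed
  then have "deviation (Suc m) \<le> (\<integral>\<omega>. ?d m \<omega> + sqnorm (Ns m) (mean_error m \<omega>) \<partial>M)"
    unfolding deviation_def
    by (intro integral_mono integrable_deviation Bochner_Integration.integrable_add
      integrable_sqnorm vec_square_integrable_mean_error)
  also have "\<dots> = deviation m + var X m / real P"
    unfolding deviation_def integral_sqnorm_mean_error[symmetric]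
    by (intro Bochner_Integration.integral_add integrable_deviation
      integrable_sqnorm vec_square_integrable_mean_error)
  finally show ?thesis .
qed

section \<open>Error of the empirical mean\<close>

text \<open>Subadditivity of the square root unrolls the recursion for \<open>deviation\<close>,
  which starts at zero since layer 0 consists of the samples themselves in both cases.\<close>

lemma sqrt_deviation_le: "sqrt (deviation m) \<le> (\<Sum>n<m. sqrt (var X n / real P))"
proof (induction m)
  case (Suc m)
  have "sqrt (deviation (Suc m)) \<le> sqrt (deviation m + var X m / real P)"
    using deviation_Suc_le by simp
  also have "\<dots> \<le> sqrt (deviation m) + sqrt (var X m / real P)"
    by (intro sqrt_add_le_add_sqrt deviation_nonneg divide_nonneg_nonneg var_nonneg) simp
  finally show ?case using Suc.IH by simp
qed (simp add: deviation_0)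

lemma vec_square_integrable_emp_mean:
  "vec_square_integrable M (Ns m) (\<lambda>\<omega> k. emp_mean Ns W P Xp m \<omega> k - mean X m k)"
proof (intro vec_square_integrable_diff vec_square_integrable_const)
  show "vec_square_integrable M (Ns m) (emp_mean Ns W P Xp m)"
    unfolding vec_square_integrable_def emp_mean_def using vec_square_integrable_emp
    by (intro allI impI square_integrable_cmult square_integrable_sum) (simp add: vec_square_integrable_def)
qed

text \<open>The error is the averaged deviation minus \<open>mean_error\<close>. A weighted Young
  inequality bounds its square pointwise, and optimising the weight after integration gives
  Minkowski's inequality.\<close>

lemma emp_mean_error_le:
  "(\<integral>\<omega>. sqnorm (Ns m) (\<lambda>k. emp_mean Ns W P Xp m \<omega> k - mean X m k) \<partial>M) \<le>
    (sqrt (deviation m) + sqrt (var X m / real P))\<^sup>2"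
proof (rule power2_sqrt_add_ge)
  let ?I = "{1..P}"
  let ?d = "\<lambda>\<omega>. (1 / real P) * (\<Sum>i\<in>?I. sqnorm (Ns m) (\<lambda>k. emp m i \<omega> k - sample m i \<omega> k))"
  fix t :: real assume t: "t > 0"
  \<comment> \<open>The gap between the two sides is exactly
    \<open>(t * u + v)\<^sup>2 / t\<close>.\<close>
  have young: "(u - v)\<^sup>2 \<le> (1 + t) * u\<^sup>2 + (1 + 1 / t) * v\<^sup>2" for u v :: real
  proof -
    have "0 \<le> (t * u + v)\<^sup>2 / t" using t by simp
    also have "\<dots> = (1 + t) * u\<^sup>2 + (1 + 1 / t) * v\<^sup>2 - (u - v)\<^sup>2"
      using t by (simp add: field_simps power2_eq_square)
    finally show ?thesis by simp
  qed
  have pt: "sqnorm (Ns m) (\<lambda>k. emp_mean Ns W P Xp m \<omega> k - mean X m k) \<le>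
      (1 + t) * ?d \<omega> + (1 + 1 / t) * sqnorm (Ns m) (mean_error m \<omega>)" for \<omega>
  proof -
    let ?a = "\<lambda>i k. emp m i \<omega> k - sample m i \<omega> k"
    have "sqnorm (Ns m) (\<lambda>k. emp_mean Ns W P Xp m \<omega> k - mean X m k) =
        sqnorm (Ns m) (\<lambda>k. (1 / real (card ?I)) * (\<Sum>i\<in>?I. ?a i k) - mean_error m \<omega> k)"
      by (simp add: emp_mean_def mean_error_def sum_subtractf diff_divide_distrib)
    also have "\<dots> \<le> (\<Sum>k<Ns m. (1 + t) * ((1 / real (card ?I)) * (\<Sum>i\<in>?I. ?a i k))\<^sup>2 +
        (1 + 1 / t) * (mean_error m \<omega> k)\<^sup>2)"
      unfolding sqnorm_def by (intro sum_mono young)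
    \<comment> \<open>Jensen's inequality over the samples passes from the squared average to the
      average of squares, which integrates to \<open>deviation m\<close>.\<close>
    also have "\<dots> \<le> (\<Sum>k<Ns m. (1 + t) * ((1 / real (card ?I)) * (\<Sum>i\<in>?I. (?a i k)\<^sup>2)) +
        (1 + 1 / t) * (mean_error m \<omega> k)\<^sup>2)"
      using t P_pos by (intro sum_mono add_right_mono mult_left_mono[OF power2_mean_le]) auto
    also have "\<dots> = (1 + t) * ?d \<omega> + (1 + 1 / t) * sqnorm (Ns m) (mean_error m \<omega>)"
      unfolding sqnorm_def sum.distrib sum_distrib_left by (subst (2) sum.swap) simp
    finally show ?thesis .
  qed
  have "(\<integral>\<omega>. sqnorm (Ns m) (\<lambda>k. emp_mean Ns W P Xp m \<omega> k - mean X m k) \<partial>M) \<le>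
      (\<integral>\<omega>. (1 + t) * ?d \<omega> + (1 + 1 / t) * sqnorm (Ns m) (mean_error m \<omega>) \<partial>M)"
    by (rule integral_mono[OF _ _ pt]) (intro integrable_deviation Bochner_Integration.integrable_add
      integrable_mult_right integrable_sqnorm vec_square_integrable_mean_error
      vec_square_integrable_emp_mean)+
  also have "\<dots> = (\<integral>\<omega>. (1 + t) * ?d \<omega> \<partial>M) + (\<integral>\<omega>. (1 + 1 / t) * sqnorm (Ns m) (mean_error m \<omega>) \<partial>M)"
    by (intro Bochner_Integration.integral_add integrable_deviation
      integrable_mult_right integrable_sqnorm vec_square_integrable_mean_error)
  also have "\<dots> = (1 + t) * deviation m + (1 + 1 / t) * (var X m / real P)"
    unfolding integral_mult_right_zero deviation_def integral_sqnorm_mean_error[symmetric] by simp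
  finally show "(\<integral>\<omega>. sqnorm (Ns m) (\<lambda>k. emp_mean Ns W P Xp m \<omega> k - mean X m k) \<partial>M) \<le>
    (1 + t) * deviation m + (1 + 1 / t) * (var X m / real P)" .
qed (simp_all add: deviation_nonneg var_nonneg)

text \<open>The bound on \<open>sqrt (deviation m)\<close> supplies the summands
  \<open>n < m\<close>; the fluctuation of the sample mean at layer \<open>m\<close> supplies the
  last one.\<close>

lemma emp_mean_error_le_var:
  "(\<integral>\<omega>. sqnorm (Ns m) (\<lambda>k. emp_mean Ns W P Xp m \<omega> k - mean X m k) \<partial>M) \<le>
    (1 / real P) * (\<Sum>n=0..m. sqrt (var X n))\<^sup>2"
proof -
  have "sqrt (deviation m) + sqrt (var X m / real P) \<le> (\<Sum>n<m. sqrt (var X n / real P)) + sqrt (var X m / real P)"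
    using sqrt_deviation_le by simp
  also have "\<dots> = (\<Sum>n=0..m. sqrt (var X n)) / sqrt (real P)"
    by (simp add: atLeast0AtMost lessThan_Suc_atMost[symmetric] real_sqrt_divide sum_divide_distrib
      add_divide_distrib)
  finally have "(sqrt (deviation m) + sqrt (var X m / real P))\<^sup>2 \<le>
      ((\<Sum>n=0..m. sqrt (var X n)) / sqrt (real P))\<^sup>2"
    by (intro power_mono) (simp_all add: deviation_nonneg var_nonneg)
  then show ?thesis
    using emp_mean_error_le[of m] by (simp add: power_divide)
qed

text \<open>Each of the \<open>m + 1\<close> variances is at most the input energy.\<close>

lemma sum_sqrt_var_le:
  "(1 / real P) * (\<Sum>n=0..m. sqrt (var X n))\<^sup>2 \<le>
    (real (m + 1))\<^sup>2 / real P * (\<integral>\<omega>. sqnorm (Ns 0) (X \<omega>) \<partial>M)"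
proof -
  let ?E = "\<integral>\<omega>. sqnorm (Ns 0) (X \<omega>) \<partial>M"
  have E: "0 \<le> ?E" by (intro integral_nonneg_AE) (simp add: sqnorm_nonneg)
  have "(\<Sum>n=0..m. sqrt (var X n)) \<le> (\<Sum>n=0..m. sqrt ?E)"
    using var_le_energy[OF X_square_integrable] by (intro sum_mono) simp
  then have "(\<Sum>n=0..m. sqrt (var X n))\<^sup>2 \<le> (real (m + 1) * sqrt ?E)\<^sup>2"
    by (intro power_mono sum_nonneg) (simp_all add: var_nonneg)
  then show ?thesis
    using E P_pos by (simp add: power_mult_distrib divide_right_mono)
qed

end

text \<open>The integrability and summability clauses guarantee that the integral of the squared
  error and the inner series are genuine rather than default values.\<close>

theorem theorem2:
  fixes M :: "'a measure" and Ns :: "nat \<Rightarrow> nat" and W :: "nat \<Rightarrow> nat \<Rightarrow> nat \<Rightarrow> complex"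
    and X :: "'a \<Rightarrow> nat \<Rightarrow> real" and Xp :: "nat \<Rightarrow> 'a \<Rightarrow> nat \<Rightarrow> real" and P :: nat
  assumes "prob_space M"
    and "\<And>m. Ns m > 0"
    and "\<And>m. m \<ge> 1 \<Longrightarrow> adj_isometry (W m) (Ns (m - 1)) (Ns m)"
    and "X \<in> borel_measurable M"
    and "\<And>\<omega> k. k \<ge> Ns 0 \<Longrightarrow> X \<omega> k = 0"
    and "integrable M (\<lambda>\<omega>. sqnorm (Ns 0) (X \<omega>))"
    and "P \<ge> 1"
    and "\<And>i. i \<in> {1..P} \<Longrightarrow> Xp i \<in> borel_measurable M"
    and "prob_space.indep_vars M (\<lambda>_. borel) Xp {1..P}"
    and "\<And>i. i \<in> {1..P} \<Longrightarrow> distr M borel (Xp i) = distr M borel X"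
  shows "\<forall>m.
     integrable M (\<lambda>\<omega>. sqnorm (Ns m) (\<lambda>k. emp_mean Ns W P Xp m \<omega> k - (\<integral>\<omega>'. layer M Ns W X m \<omega>' k \<partial>M)))
   \<and> (\<forall>n. summable (\<lambda>k. sqnorm (Ns (k + n + 1)) (\<lambda>j. \<integral>\<omega>. layer M Ns W X (k + n + 1) \<omega> j \<partial>M)))
   \<and> (\<integral>\<omega>. sqnorm (Ns m) (\<lambda>k. emp_mean Ns W P Xp m \<omega> k - (\<integral>\<omega>'. layer M Ns W X m \<omega>' k \<partial>M)) \<partial>M)
       \<le> (1 / real P) * (\<Sum>n=0..m. sqrt (\<Sum>k. sqnorm (Ns (k + n + 1))
              (\<lambda>j. \<integral>\<omega>. layer M Ns W X (k + n + 1) \<omega> j \<partial>M)))\<^sup>2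
   \<and> (1 / real P) * (\<Sum>n=0..m. sqrt (\<Sum>k. sqnorm (Ns (k + n + 1))
              (\<lambda>j. \<integral>\<omega>. layer M Ns W X (k + n + 1) \<omega> j \<partial>M)))\<^sup>2
       \<le> (real (m + 1))\<^sup>2 / real P * (\<integral>\<omega>. sqnorm (Ns 0) (X \<omega>) \<partial>M)"
proof -
  interpret prob_space M by fact
  \<comment> \<open>Coordinate projections are measurable, and each squared coordinate is dominated
    by the integrable squared norm.\<close>
  have X: "vec_square_integrable M (Ns 0) X"
    unfolding vec_square_integrable_def
  proof (intro allI impI)
    fix k assume "k < Ns 0"
    then show "square_integrable M (\<lambda>\<omega>. X \<omega> k)"
      using measurable_compose[OF assms(4) measurable_product_coordinates] assms(6)
      by (blast intro: square_integrable_bound power2_component_le_sqnorm)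
  qed
  interpret scattering_sample M Ns W X Xp P
  proof unfold_locales
    show "adj_isometry (W (Suc m)) (Ns m) (Ns (Suc m))" for m
      using assms(3)[of "Suc m"] by simp
  qed (use assms X in auto)
  \<comment> \<open>The index \<open>k + n + 1\<close> runs over the layers strictly after
    \<open>n\<close>, so \<open>var X n\<close> is the value of the inner series.\<close>
  have eqs: "(\<lambda>k. sqnorm (Ns (k + n + 1)) (\<lambda>j. \<integral>\<omega>. layer M Ns W X (k + n + 1) \<omega> j \<partial>M)) sums var X n" for n
    using mean_energy_sums[OF X, of n] unfolding mean_def Suc_eq_plus1 .
  show ?thesis
    unfolding sums_unique[OF eqs, symmetric]
    using integrable_sqnorm[OF vec_square_integrable_emp_mean] sums_summable[OF eqs]
      emp_mean_error_le_var sum_sqrt_var_le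
    unfolding mean_def by blast
qed

end
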